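(* As an identity for complex $q$ with $|q|<1$ (equivalently, of formal power series in $q$), $$\sum_{n_1\ge1}\left(q^{n_1}+2q^{2n_1}+3q^{3n_1}+\cdots\right)\frac{1}{(q^{n_1+1})_{\infty}}\sum_{n_2\ge1}\left(q^{n_2}+2q^{2n_2}+3q^{3n_2}+\cdots\right)\frac{1}{(1-q^{n_2+1})(1-q^{n_2+2})\cdots(1-q^{n_2+n_1})}$$ $$=\frac{1}{(q)_{\infty}}\left(\sum_{n\ge1}\frac{nq^n}{1-q^n}\right)^2+\frac{1}{(q)_{\infty}}\sum_{\substack{n\in\mathbb{Z}\\ n\neq0}}\frac{(-1)^{n}q^{3n(n+1)/2}}{(1-q^n)^4}.$$ Here the sum over $n_2$ depends on $n_1$ and lies inside the sum over $n_1$.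
   Context: Notation: $(X)_n=(X;q)_n:=\prod_{0\le k\le n-1}(1-Xq^k)$ and $(X)_\infty=(X;q)_\infty:=\prod_{k\ge0}(1-Xq^k)$. The expression $q^{m}+2q^{2m}+3q^{3m}+\cdots$ denotes $\sum_{i\ge1} i\,q^{im}=q^{m}/(1-q^{m})^2$. In the sum over nonzero integers $n$, terms with negative $n$ are the rational functions of $q$ given by the formula (for $n=-m$, $m\ge1$, the term equals $(-1)^m q^{m(3m+5)/2}/(1-q^m)^4$), expanded in powers of $q$. *)

theory Defs
  imports "HOL-Analysis.Analysis"
begin

definition qpoch_inf :: "complex \<Rightarrow> complex \<Rightarrow> complex" where
  "qpoch_inf X q = (\<Prod>k. 1 - X * q ^ k)"

definition weighted_geom :: "complex \<Rightarrow> nat \<Rightarrow> complex" where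
  "weighted_geom q m = (\<Sum>\<^sub>\<infinity>i\<in>{1..}. of_nat i * q ^ (i * m))"

(* The rational function (-1)^n q^(3n(n+1)/2) / (1-q^n)^4 of q, for a nonzero integer n.  For every
   such n it is regular at q = 0 with value 0 there.  For n < 0 the bare formula would not give this
   value, since 0 powi n = 0 for n < 0 and 0 powi 0 = 1; hence the case distinction. *)
definition bilateral_term :: "complex \<Rightarrow> int \<Rightarrow> complex" where
  "bilateral_term q n =
     (if q = 0 then 0
      else (-1) powi n * q powi (3 * n * (n + 1) div 2) / (1 - q powi n) ^ 4)"

lemma bilateral_term_pos:
  assumes "m \<ge> 1"
  shows "bilateral_term q (int m) = (-1) ^ m * q ^ (3 * m * (m + 1) div 2) / (1 - q ^ m) ^ 4"
proof -
  have e: "3 * int m * (int m + 1) div 2 = int (3 * m * (m + 1) div 2)"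
    by (simp add: zdiv_int algebra_simps)
  have "3 * m * (m + 1) \<ge> 3 * 1 * (1 + 1)"
    using assms by (intro mult_mono) auto
  from order_trans[OF _ this, of 2] have "3 * m * (m + 1) div 2 > 0"
    by (simp add: div_greater_zero_iff)
  then have z: "0 ^ (3 * m * (m + 1) div 2) = (0::complex)" by (simp only: zero_power)
  show ?thesis
    unfolding bilateral_term_def e power_int_of_nat using z by auto
qed

lemma bilateral_term_neg:
  assumes "m \<ge> 1"
  shows "bilateral_term q (- int m) = (-1) ^ m * q ^ (m * (3 * m + 5) div 2) / (1 - q ^ m) ^ 4"
proof (cases "q = 0")
  case True
  have "m * (3 * m + 5) \<ge> 1 * (3 * 1 + 5)"
    using assms by (intro mult_mono) auto
  from order_trans[OF _ this, of 2] have "m * (3 * m + 5) div 2 > 0"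
    by (simp add: div_greater_zero_iff)
  then have "0 ^ (m * (3 * m + 5) div 2) = (0::complex)" by (simp only: zero_power)
  then show ?thesis using True by (simp add: bilateral_term_def)
next
  case False
  define k where "k = 3 * m * (m - 1) div 2"
  have "m * (3 * m + 5) = 3 * m * (m - 1) + 2 * (4 * m)"
    using assms by (cases m) (auto simp: algebra_simps)
  then have k2: "m * (3 * m + 5) div 2 = k + 4 * m"
    unfolding k_def by simp
  have "3 * (- int m) * (- int m + 1) = int (3 * m * (m - 1))"
    using assms by (simp add: of_nat_diff algebra_simps)
  then have k1: "3 * (- int m) * (- int m + 1) div 2 = int k"
    unfolding k_def by (simp add: zdiv_int)
  have d: "1 - q powi (- int m) = - ((1 - q ^ m) / q ^ m)"
    using False by (simp add: power_int_minus field_simps)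
  have s: "(-1) powi (- int m) = ((-1) ^ m :: complex)"
    by (simp add: power_int_minus flip: power_inverse)
  show ?thesis
    unfolding bilateral_term_def k1 k2 d s power_int_of_nat
    using False by (simp add: power_divide power_add power_mult mult.commute[of 4])
qed

end

theory Submission
  imports Defs
begin

text \<open>
  Write $(q)_n = \prod_{k=1}^n (1-q^k)$ and $u_n = \sum_{i \ge 1} i q^{in} = q^n/(1-q^n)^2$. Since
  $1/(q^{a+1})_\infty = (q)_a/(q)_\infty$, the left-hand side is $1/(q)_\infty$ times the symmetric
  double sum of $u_a u_b C(a,b)$ with $C(a,b) = (q)_a (q)_b/(q)_{a+b}$. The proof evaluates the two
  summations one after the other, each time because a difference telescopes.

  \<^item> Inner sum (\<open>inner_series_sums\<close>). The quotient $C$ satisfies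
    $u_b (C(a-1,b) - C(a,b)) = u_a (C(a,b-1) - C(a,b))$. Summing over $b$, the right-hand side
    telescopes to $u_a (1 - (q)_a)$. Hence, by induction on $a$, the inner sum is
    $A + E_a$ with $A = \sum_n u_n$ and $E_a = \sum_{j \le a} u_j ((q)_j - 1)$.
    The summand $A$ contributes $A^2$ to the double sum, and $A$ is the Lambert series
    $\sum_n n q^n/(1-q^n)$ (\<open>Lambert_has_sum\<close>).

  \<^item> Outer sum. Let $\alpha_r = (-1)^r q^{r(3r-1)/2} (1+q^r)$ and $K(n,r) = 1/((q)_{n-r} (q)_{n+r})$.
    The numbers $\alpha_r$ (with $\alpha_0 = 1$) and $\beta_n = 1/(q)_n$ form a Bailey pair relative
    to $1$: $\sum_{r=0}^n \alpha_r K(n,r) = 1/(q)_n$ (\<open>bailey_pair_sum\<close>). The normalised kernel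
    $G(n,r) = (q)_n^2 K(n,r)$ satisfies
    $u_n G(n,r) = u_r (G(n,r) - G(n-1,r))$ (\<open>geom2_mult_kernel\<close>), so multiplication by $u_n$
    is summation by parts in $n$ at the price of a factor $u_r$. Used once, this turns the Bailey
    pair into $E_n = \sum_{r=1}^n u_r \alpha_r G(n,r)$ (\<open>sum_geom2_qpoch\<close>); used twice, it gives
    $\sum_{a \le n} u_a E_a = \sum_{r=1}^n u_r^2 \alpha_r G(n,r)$ (\<open>double_sum_geom2_qpoch\<close>).
    As $G(n,r)$ tends to $1$ and is bounded, Tannery's theorem yields $\sum_r u_r^2 \alpha_r$
    (\<open>correction_series_sums\<close>).

  Finally $u_r^2 \alpha_r$ is the sum of the terms of the bilateral series with indices $r$ and $-r$
  (\<open>bilateral_term_pair\<close>).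
\<close>

section \<open>The finite products $(q)_n$ and the Bailey kernel\<close>

lemma one_minus_power_nonzero:
  fixes q :: "'a :: real_normed_field"
  assumes "norm q < 1" "n \<ge> 1"
  shows "1 - q ^ n \<noteq> 0"
proof
  assume "1 - q ^ n = 0"
  then have "norm q ^ n = 1" by (metis eq_iff_diff_eq_0 norm_one norm_power)
  moreover have "norm q ^ n < 1" using assms by (simp add: power_less_one_iff)
  ultimately show False by simp
qed

definition qpoch :: "complex \<Rightarrow> nat \<Rightarrow> complex" where
  "qpoch q n = (\<Prod>k=1..n. 1 - q ^ k)"

text \<open>
  The closed form of $\sum_{i \ge 1} i q^{in}$ for $n \ge 1$. At $n = 0$ it is $1/0 = 0$, so that sums
  and series of this function may start at $0$ or at $1$.
\<close>
definition geom2 :: "complex \<Rightarrow> nat \<Rightarrow> complex" where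
  "geom2 q n = q ^ n / (1 - q ^ n)\<^sup>2"

text \<open>
  The kernel of Bailey pairs relative to $1$. The value $0$ for $r > n$ is the usual convention
  $1/(q)_{-k} = 0$ for $k \ge 1$; it lets sums over $r \le n$ be extended to $r \le n + 1$.
\<close>
definition bailey_kernel :: "complex \<Rightarrow> nat \<Rightarrow> nat \<Rightarrow> complex" where
  "bailey_kernel q n r = (if r \<le> n then 1 / (qpoch q (n - r) * qpoch q (n + r)) else 0)"

text \<open>
  For $r \ge 1$ this is $(-1)^r q^{r(3r-1)/2} (1+q^r)$. The binomial coefficient keeps the exponent free
  of division and of subtraction.
\<close>
definition bailey_alpha :: "complex \<Rightarrow> nat \<Rightarrow> complex" where
  "bailey_alpha q r = (-1) ^ r * q ^ (3 * (r choose 2) + r) * (1 + q ^ r)"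

lemma qpoch_0 [simp]: "qpoch q 0 = 1"
  by (simp add: qpoch_def)

lemma qpoch_Suc: "qpoch q (Suc n) = qpoch q n * (1 - q ^ Suc n)"
  by (simp add: qpoch_def)

lemma qpoch_nonzero: "norm q < 1 \<Longrightarrow> qpoch q n \<noteq> 0"
  by (simp add: qpoch_def one_minus_power_nonzero del: right_minus_eq)

lemma bailey_kernel_Suc:
  assumes "norm q < 1" "r \<le> Suc n"
  shows "bailey_kernel q n r =
    bailey_kernel q (Suc n) r * ((1 - q ^ (Suc n - r)) * (1 - q ^ (Suc n + r)))"
proof (cases "r \<le> n")
  case True
  then have "Suc n - r = Suc (n - r)" by simp
  then show ?thesis
    using True one_minus_power_nonzero[OF assms(1), of "Suc (n - r)"]
      one_minus_power_nonzero[OF assms(1), of "Suc (n + r)"] qpoch_nonzero[OF assms(1)]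
    by (simp add: bailey_kernel_def qpoch_Suc del: power_Suc)
next
  case False
  with assms have "r = Suc n" by simp
  then show ?thesis by (simp add: bailey_kernel_def)
qed

lemma bailey_kernel_pred:
  assumes "norm q < 1" "r < n"
  shows "bailey_kernel q n r * (1 - q ^ (n - r)) =
    bailey_kernel q n (Suc r) * (1 - q ^ (n + Suc r))"
proof -
  have "n - r = Suc (n - Suc r)" using assms by simp
  then show ?thesis
    using assms(2) one_minus_power_nonzero[OF assms(1), of "Suc (n - Suc r)"]
      one_minus_power_nonzero[OF assms(1), of "Suc (n + r)"] qpoch_nonzero[OF assms(1)]
    by (simp add: bailey_kernel_def qpoch_Suc del: power_Suc)
qed

section \<open>The finite identities\<close>

text \<open>
  The pentagonal Bailey pair, multiplied by $(q)_n$ and with the term for $r = 0$ moved to the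
  right-hand side. Increasing $n - 1$ to $n$ changes the $r$-th summand of $(q)_n \sum_r \alpha_r K(n,r)$
  by $\alpha_r (q)_{n-1} K(n,r)$ times $(1-q^n) - (1-q^{n-r})(1-q^{n+r}) = q^n (q^{-r} - 1 + q^r - q^n)$. Because of
  $(1+q^r)(q^{-r} - 1 + q^r) = q^{-r}(1+q^{3r})$, this increment is a difference $g(r) - g(r-1)$ of explicit
  terms, so that the sum over $r$ telescopes.
\<close>
lemma bailey_pair_sum:
  assumes q: "norm q < 1"
  shows "qpoch q n * (\<Sum>r=1..n. bailey_alpha q r * bailey_kernel q n r) = 1 - 1 / qpoch q n"
proof (induction n)
  case 0
  show ?case by simp
next
  case (Suc n)
  define N where "N = Suc n"
  \<comment> \<open>The telescoping certificate for the step from $n$ to $N = n + 1$; its last value $g(N)$ is $0$.\<close>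
  define g where "g r = (-1) ^ r * q ^ (3 * (Suc r choose 2) + N) * qpoch q n *
    (bailey_kernel q N r * (1 - q ^ (N - r)))" for r
  have step: "bailey_alpha q (Suc r) * (qpoch q N * bailey_kernel q N (Suc r) - qpoch q n * bailey_kernel q n (Suc r))
      = g (Suc r) - g r" if "r \<le> n" for r
  proof -
    obtain d where n: "n = d + r" using \<open>r \<le> n\<close> by (metis add.commute le_Suc_ex)
    have choose: "Suc r choose 2 = (r choose 2) + r" "Suc (Suc r) choose 2 = (r choose 2) + 2 * r + 1"
      by (simp_all add: numeral_2_eq_2)
    have kernel: "bailey_kernel q n (Suc r) =
        bailey_kernel q N (Suc r) * ((1 - q ^ (N - Suc r)) * (1 - q ^ (N + Suc r)))"
      unfolding N_def using that by (intro bailey_kernel_Suc q) simp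
    have g: "g r = (-1) ^ r * q ^ (3 * (Suc r choose 2) + N) * qpoch q n *
        (bailey_kernel q N (Suc r) * (1 - q ^ (N + Suc r)))"
      unfolding g_def using that by (subst bailey_kernel_pred[OF q]) (auto simp: N_def)
    have fact: "qpoch q N = qpoch q n * (1 - q ^ N)" by (simp add: N_def qpoch_Suc)
    have exps: "N - Suc r = d" "N = d + r + 1" "N + Suc r = d + 2 * r + 2"
      using n by (simp_all add: N_def)
    \<comment> \<open>In these three quantities and $q$ the certificate is a polynomial identity.\<close>
    define w where "w = q ^ (r choose 2)"
    define y where "y = q ^ r"
    define x where "x = q ^ d"
    have power_numeral: "q ^ (numeral j * k) = (q ^ k) ^ numeral j" for j k
      by (simp add: mult.commute flip: power_mult)
    have powers: "q ^ (N - Suc r) = x" "q ^ N = x * y * q" "q ^ (N + Suc r) = x * (y * q)\<^sup>2"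
      "q ^ Suc r = y * q" "q ^ (3 * (Suc r choose 2) + Suc r) = (w * y) ^ 3 * (y * q)"
      "q ^ (3 * (Suc (Suc r) choose 2) + N) = (w * y\<^sup>2 * q) ^ 3 * (x * y * q)"
      "q ^ (3 * (Suc r choose 2) + N) = (w * y) ^ 3 * (x * y * q)"
      unfolding w_def y_def x_def using exps choose
      by (simp_all add: power_add power_numeral power_mult_distrib,
          simp_all add: eval_nat_numeral mult_ac)
    have key: "(q ^ (3 * (Suc r choose 2) + Suc r) * (1 + q ^ Suc r)) *
       ((1 - q ^ N) - (1 - q ^ (N - Suc r)) * (1 - q ^ (N + Suc r)))
       = q ^ (3 * (Suc (Suc r) choose 2) + N) * (1 - q ^ (N - Suc r)) +
         q ^ (3 * (Suc r choose 2) + N) * (1 - q ^ (N + Suc r))"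
      unfolding powers by algebra
    have "bailey_alpha q (Suc r) * (qpoch q N * bailey_kernel q N (Suc r) - qpoch q n * bailey_kernel q n (Suc r))
      = (-1) ^ Suc r * qpoch q n * bailey_kernel q N (Suc r) *
        (q ^ (3 * (Suc (Suc r) choose 2) + N) * (1 - q ^ (N - Suc r)) +
         q ^ (3 * (Suc r choose 2) + N) * (1 - q ^ (N + Suc r)))"
      unfolding kernel fact bailey_alpha_def key[symmetric] by (simp only: algebra_simps)
    also have "\<dots> = g (Suc r) - g r"
      unfolding g unfolding g_def power_Suc by algebra
    finally show ?thesis .
  qed
  have "qpoch q N * (\<Sum>r=1..N. bailey_alpha q r * bailey_kernel q N r)
      - qpoch q n * (\<Sum>r=1..N. bailey_alpha q r * bailey_kernel q n r)
      = (\<Sum>r\<le>n. bailey_alpha q (Suc r) * (qpoch q N * bailey_kernel q N (Suc r)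
            - qpoch q n * bailey_kernel q n (Suc r)))"
    unfolding sum_distrib_left sum_subtractf[symmetric]
    unfolding N_def One_nat_def sum.atLeast_Suc_atMost_Suc_shift atMost_atLeast0
    by (simp only: o_def algebra_simps)
  also have "\<dots> = (\<Sum>r\<le>n. g (Suc r) - g r)"
    by (intro sum.cong) (auto simp: step)
  also have "\<dots> = g N - g 0"
    by (simp add: N_def lessThan_Suc_atMost[symmetric] sum_lessThan_telescope)
  also have "\<dots> = - (q ^ N / qpoch q N)"
    using one_minus_power_nonzero[OF q, of N] qpoch_nonzero[OF q, of n]
    by (simp add: g_def bailey_kernel_def N_def qpoch_Suc choose_two del: power_Suc)
  also have "\<dots> = 1 / qpoch q n - 1 / qpoch q N"
    using one_minus_power_nonzero[OF q, of N] qpoch_nonzero[OF q, of n]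
    by (simp add: N_def qpoch_Suc field_simps del: power_Suc)
  finally have sum_eq: "qpoch q N * (\<Sum>r=1..N. bailey_alpha q r * bailey_kernel q N r) =
      qpoch q n * (\<Sum>r=1..N. bailey_alpha q r * bailey_kernel q n r) + (1 / qpoch q n - 1 / qpoch q N)"
    by (simp add: algebra_simps)
  have drop_last: "(\<Sum>r=1..N. bailey_alpha q r * bailey_kernel q n r) = (\<Sum>r=1..n. bailey_alpha q r * bailey_kernel q n r)"
    by (simp add: N_def bailey_kernel_def)
  show ?case
    unfolding N_def[symmetric] sum_eq drop_last Suc.IH by simp
qed

text \<open>
  Summation by parts for the normalised kernel. Up to common factors its difference in $n$ is
  $(1-q^n)^2 - (1-q^{n-r})(1-q^{n+r}) = q^{n-r} (1-q^r)^2$, and the factor $(1-q^r)^2 / q^r$ is cancelled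
  by \<open>geom2 q r\<close>.
\<close>
lemma geom2_mult_kernel:
  assumes q: "norm q < 1" and r: "r \<ge> 1"
  shows "geom2 q (Suc n) * ((qpoch q (Suc n))\<^sup>2 * bailey_kernel q (Suc n) r) =
    geom2 q r * ((qpoch q (Suc n))\<^sup>2 * bailey_kernel q (Suc n) r - (qpoch q n)\<^sup>2 * bailey_kernel q n r)"
proof (cases "r \<le> Suc n")
  case False
  then show ?thesis by (simp add: bailey_kernel_def)
next
  case True
  define N where "N = Suc n"
  define y where "y = q ^ r"
  define x where "x = q ^ (N - r)"
  have "q ^ N = x * y" using True by (simp add: N_def x_def y_def flip: power_add)
  moreover have "1 - q ^ N \<noteq> 0" "1 - y \<noteq> 0"
    unfolding y_def N_def using one_minus_power_nonzero[OF q, of "Suc n"] one_minus_power_nonzero[OF q, of r] r by simp_all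
  moreover have "((F * (1 - x * y))\<^sup>2 * K - F\<^sup>2 * (K * ((1 - x) * (1 - x * y * y)))) =
      x * (1 - y)\<^sup>2 * F\<^sup>2 * K" for F K
    by algebra
  ultimately show ?thesis
    unfolding bailey_kernel_Suc[OF q True] qpoch_Suc geom2_def power_add
    unfolding N_def[symmetric] y_def[symmetric] x_def[symmetric]
    by (simp add: power_mult_distrib)
qed

text \<open>
  By \<open>geom2_mult_kernel\<close> the increment of the right-hand side is the Bailey sum times
  $u_n (q)_n^2$, which the Bailey pair evaluates to $u_n ((q)_n - 1)$.
\<close>
lemma sum_geom2_qpoch:
  assumes q: "norm q < 1"
  shows "(\<Sum>j=1..n. geom2 q j * (qpoch q j - 1)) =
    (\<Sum>r=1..n. geom2 q r * bailey_alpha q r * ((qpoch q n)\<^sup>2 * bailey_kernel q n r))"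
proof (induction n)
  case 0
  show ?case by simp
next
  case (Suc n)
  let ?G = "\<lambda>n r. (qpoch q n)\<^sup>2 * bailey_kernel q n r"
  have "(\<Sum>r=1..Suc n. geom2 q r * bailey_alpha q r * ?G (Suc n) r) -
      (\<Sum>r=1..Suc n. geom2 q r * bailey_alpha q r * ?G n r)
      = (\<Sum>r=1..Suc n. bailey_alpha q r * (geom2 q r * (?G (Suc n) r - ?G n r)))"
    unfolding sum_subtractf[symmetric] by (simp only: algebra_simps)
  also have "\<dots> = (\<Sum>r=1..Suc n. bailey_alpha q r * (geom2 q (Suc n) * ?G (Suc n) r))"
    by (intro sum.cong refl) (simp only: geom2_mult_kernel[OF q] atLeastAtMost_iff)
  also have "\<dots> = geom2 q (Suc n) * qpoch q (Suc n) *
      (qpoch q (Suc n) * (\<Sum>r=1..Suc n. bailey_alpha q r * bailey_kernel q (Suc n) r))"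
    unfolding sum_distrib_left by (simp only: power2_eq_square mult_ac)
  also have "\<dots> = geom2 q (Suc n) * (qpoch q (Suc n) - 1)"
    unfolding bailey_pair_sum[OF q] using qpoch_nonzero[OF q, of "Suc n"] by (simp add: field_simps)
  finally show ?case using Suc.IH by (simp add: bailey_kernel_def algebra_simps)
qed

text \<open>
  The same summation by parts once more: the increment in $n$ of the right-hand side is $u_n$ times
  the right-hand side of \<open>sum_geom2_qpoch\<close>.
\<close>
lemma double_sum_geom2_qpoch:
  assumes q: "norm q < 1"
  shows "(\<Sum>a=1..n. geom2 q a * (\<Sum>j=1..a. geom2 q j * (qpoch q j - 1))) =
    (\<Sum>r=1..n. (geom2 q r)\<^sup>2 * bailey_alpha q r * ((qpoch q n)\<^sup>2 * bailey_kernel q n r))"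
proof (induction n)
  case 0
  show ?case by simp
next
  case (Suc n)
  let ?G = "\<lambda>n r. (qpoch q n)\<^sup>2 * bailey_kernel q n r"
  have "(\<Sum>r=1..Suc n. (geom2 q r)\<^sup>2 * bailey_alpha q r * ?G (Suc n) r) -
      (\<Sum>r=1..Suc n. (geom2 q r)\<^sup>2 * bailey_alpha q r * ?G n r)
      = (\<Sum>r=1..Suc n. geom2 q r * bailey_alpha q r * (geom2 q r * (?G (Suc n) r - ?G n r)))"
    unfolding sum_subtractf[symmetric] by (simp only: algebra_simps power2_eq_square)
  also have "\<dots> = (\<Sum>r=1..Suc n. geom2 q r * bailey_alpha q r * (geom2 q (Suc n) * ?G (Suc n) r))"
    by (intro sum.cong refl) (simp only: geom2_mult_kernel[OF q] atLeastAtMost_iff)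
  also have "\<dots> = geom2 q (Suc n) * (\<Sum>j=1..Suc n. geom2 q j * (qpoch q j - 1))"
    unfolding sum_geom2_qpoch[OF q] sum_distrib_left by (simp only: mult_ac)
  finally show ?case using Suc.IH by (simp add: bailey_kernel_def algebra_simps)
qed

section \<open>Convergence and bounds\<close>

lemma convergent_prod_qpoch:
  fixes q :: complex
  assumes "norm q < 1"
  shows "convergent_prod (\<lambda>k. 1 - X * q ^ k)"
  using assms
  by (intro abs_convergent_prod_imp_convergent_prod)
    (simp add: abs_convergent_prod_conv_summable norm_mult norm_power summable_mult summable_geometric)

lemma qpoch_conv_lessThan: "qpoch q n = (\<Prod>k<n. 1 - q * q ^ k)"
  by (induction n) (simp_all add: qpoch_Suc)

lemma qpoch_inf_nonzero:
  assumes "norm q < 1"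
  shows "qpoch_inf q q \<noteq> 0"
  unfolding qpoch_inf_def
proof (rule prodinf_nonzero)
  show "1 - q * q ^ i \<noteq> 0" for i
    using one_minus_power_nonzero[OF assms, of "Suc i"] by simp
qed (rule convergent_prod_qpoch[OF assms])

lemma qpoch_tendsto:
  assumes "norm q < 1"
  shows "qpoch q \<longlonglongrightarrow> qpoch_inf q q"
  using convergent_prod_LIMSEQ[OF convergent_prod_qpoch[OF assms, of q]]
  unfolding qpoch_inf_def qpoch_conv_lessThan[abs_def]
  by (subst LIMSEQ_lessThan_iff_atMost)

lemma qpoch_inf_tail:
  assumes "norm q < 1"
  shows "qpoch_inf (q ^ (n + 1)) q = qpoch_inf q q / qpoch q n"
proof -
  have "(\<Prod>k. 1 - q * q ^ (k + n)) = qpoch_inf q q / qpoch q n"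
    unfolding qpoch_inf_def qpoch_conv_lessThan
    using one_minus_power_nonzero[OF assms, of "Suc _"]
    by (intro prodinf_divide_initial_segment convergent_prod_qpoch assms) simp
  then show ?thesis
    by (simp add: qpoch_inf_def power_add mult_ac)
qed

text \<open>
  The reciprocals are bounded because $(q)_\infty$ is nonzero. These bounds dominate all quotients of
  the $(q)_n$ that occur in the series below.
\<close>
lemma qpoch_bounds:
  assumes "norm q < 1"
  obtains B where "\<And>n. norm (qpoch q n) \<le> B" "\<And>n. norm (1 / qpoch q n) \<le> B" "B \<ge> 0"
proof -
  have "Bseq (qpoch q)"
    using qpoch_tendsto[OF assms] by (intro convergent_imp_Bseq convergentI)
  then obtain B1 where B1: "\<And>n. norm (qpoch q n) \<le> B1" by (meson BseqE)
  have "(\<lambda>n. 1 / qpoch q n) \<longlonglongrightarrow> 1 / qpoch_inf q q"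
    using qpoch_tendsto[OF assms] qpoch_inf_nonzero[OF assms] by (intro tendsto_intros)
  then have "Bseq (\<lambda>n. 1 / qpoch q n)"
    by (intro convergent_imp_Bseq convergentI)
  then obtain B2 where B2: "\<And>n. norm (1 / qpoch q n) \<le> B2" by (meson BseqE)
  show ?thesis
    using that[of "max B1 B2"] B1 B2 norm_ge_zero[of "qpoch q 0"]
    by (meson le_max_iff_disj order_trans)
qed

lemma norm_one_minus_power_ge:
  fixes q :: "'a :: real_normed_field"
  assumes "norm q < 1" "n \<ge> 1"
  shows "norm (1 - q ^ n) \<ge> 1 - norm q"
proof -
  have "norm q ^ n \<le> norm q ^ 1" using assms by (intro power_decreasing) auto
  then have "1 - norm q \<le> norm (1::'a) - norm (q ^ n)" by (simp add: norm_power)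
  also have "\<dots> \<le> norm (1 - q ^ n)" by (rule norm_triangle_ineq2)
  finally show ?thesis .
qed

lemma norm_power_over_le:
  fixes q :: "'a :: real_normed_field"
  assumes q: "norm q < 1" and n: "n \<ge> 1" "k \<ge> n"
  shows "norm (q ^ k / (1 - q ^ n) ^ j) \<le> norm q ^ n / (1 - norm q) ^ j"
proof -
  have "norm q ^ k \<le> norm q ^ n" using assms by (intro power_decreasing) auto
  then show ?thesis
    unfolding norm_divide norm_power using q norm_one_minus_power_ge[OF q n(1)]
    by (intro frac_le power_mono zero_less_power) (auto simp: norm_power)
qed

lemma geom2_0 [simp]: "geom2 q 0 = 0"
  by (simp add: geom2_def)

lemma norm_geom2_le:
  assumes q: "norm q < 1"
  shows "norm (geom2 q n) \<le> norm q ^ n / (1 - norm q)\<^sup>2"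
proof (cases n)
  case (Suc m)
  then show ?thesis unfolding geom2_def by (intro norm_power_over_le q) auto
qed simp

lemma summable_norm_geom2_mult:
  assumes q: "norm q < 1" and h: "\<And>n. norm (h n) \<le> c"
  shows "summable (\<lambda>n. norm (geom2 q n * h n))"
proof (rule summable_comparison_test')
  show "summable (\<lambda>n. norm q ^ n / (1 - norm q)\<^sup>2 * c)"
    using q by (intro summable_mult2 summable_divide summable_geometric) auto
  have "norm (geom2 q n * h n) \<le> norm q ^ n / (1 - norm q)\<^sup>2 * c" for n
    unfolding norm_mult using norm_geom2_le[OF q] h by (intro mult_mono) auto
  then show "norm (norm (geom2 q n * h n)) \<le> norm q ^ n / (1 - norm q)\<^sup>2 * c" for n
    by simp
qed

lemma summable_norm_geom2:
  assumes q: "norm q < 1"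
  shows "summable (\<lambda>n. norm (geom2 q n))"
  using summable_norm_geom2_mult[OF q, of "\<lambda>_. 1" 1] by simp

section \<open>The inner and the outer series\<close>

text \<open>
  Induction on $a$: passing from $a$ to $a + 1$ changes the series by the series of
  $u_b (C(a,b) - C(a+1,b))$, and this equals $u_{a+1} (C(a+1,b-1) - C(a+1,b))$, which telescopes
  from $C(a+1,0) = 1$ to $\lim_b C(a+1,b) = (q)_{a+1}$.
\<close>
lemma inner_series_sums:
  assumes q: "norm q < 1"
  shows "(\<lambda>b. geom2 q b * (qpoch q a * qpoch q b / qpoch q (a + b))) sums
    (suminf (geom2 q) + (\<Sum>j=1..a. geom2 q j * (qpoch q j - 1)))"
proof (induction a)
  case 0
  have "summable (geom2 q)" using summable_norm_geom2[OF q] by (rule summable_norm_cancel)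
  then show ?case using qpoch_nonzero[OF q] by (simp add: summable_sums)
next
  case (Suc a)
  define C where "C a b = qpoch q a * qpoch q b / qpoch q (a + b)" for a b
  have step: "geom2 q (Suc b) * (C a (Suc b) - C (Suc a) (Suc b)) =
      geom2 q (Suc a) * (C (Suc a) b - C (Suc a) (Suc b))" for b
  proof -
    define x where "x = q ^ Suc a"
    define y where "y = q ^ Suc b"
    define P where "P = qpoch q a * qpoch q b / qpoch q (Suc (Suc (a + b)))"
    have nz: "1 - x \<noteq> 0" "1 - y \<noteq> 0" "1 - x * y \<noteq> 0"
      using one_minus_power_nonzero[OF q, of "Suc a"] one_minus_power_nonzero[OF q, of "Suc b"]
        one_minus_power_nonzero[OF q, of "Suc a + Suc b"] unfolding x_def y_def power_add by simp_all
    have last: "qpoch q (Suc (Suc (a + b))) = qpoch q (Suc (a + b)) * (1 - x * y)"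
      by (simp add: qpoch_Suc x_def y_def power_add mult_ac)
    have C: "C a (Suc b) = P * (1 - y) * (1 - x * y)" "C (Suc a) b = P * (1 - x) * (1 - x * y)"
      "C (Suc a) (Suc b) = P * (1 - x) * (1 - y)"
      unfolding C_def P_def add_Suc add_Suc_right last
      using nz qpoch_nonzero[OF q, of "Suc (a + b)"]
      by (simp_all add: qpoch_Suc[of q a] qpoch_Suc[of q b] x_def[symmetric] y_def[symmetric] del: power_Suc)
    have "P * (1 - y) * (1 - x * y) - P * (1 - x) * (1 - y) = x * P * (1 - y)\<^sup>2"
      "P * (1 - x) * (1 - x * y) - P * (1 - x) * (1 - y) = y * P * (1 - x)\<^sup>2"
      by algebra+
    then show ?thesis
      unfolding C geom2_def x_def[symmetric] y_def[symmetric] using nz by simp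
  qed
  have "C (Suc a) \<longlonglongrightarrow> qpoch q (Suc a) * qpoch_inf q q / qpoch_inf q q"
    unfolding C_def add.commute[of "Suc a"]
    using LIMSEQ_ignore_initial_segment[OF qpoch_tendsto[OF q]] qpoch_tendsto[OF q] qpoch_inf_nonzero[OF q]
    by (intro tendsto_intros)
  then have "C (Suc a) \<longlonglongrightarrow> qpoch q (Suc a)" using qpoch_inf_nonzero[OF q] by simp
  from telescope_sums'[OF this]
  have "(\<lambda>b. geom2 q (Suc b) * (C a (Suc b) - C (Suc a) (Suc b))) sums
      (geom2 q (Suc a) * (1 - qpoch q (Suc a)))"
    unfolding step using qpoch_nonzero[OF q] by (intro sums_mult) (simp add: C_def)
  then have "(\<lambda>b. geom2 q b * (C a b - C (Suc a) b)) sums (geom2 q (Suc a) * (1 - qpoch q (Suc a)))"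
    by (subst (asm) sums_Suc_iff) simp
  from sums_diff[OF Suc.IH[folded C_def] this] show ?case
    unfolding C_def[symmetric] by (simp add: algebra_simps)
qed

lemma norm_qpoch_ratio_le:
  assumes "\<And>n. norm (qpoch q n) \<le> B" "\<And>n. norm (1 / qpoch q n) \<le> B" "B \<ge> 0"
  shows "norm (qpoch q a * qpoch q b / qpoch q c) \<le> B ^ 3"
proof -
  have "norm (qpoch q a * qpoch q b * (1 / qpoch q c)) \<le> B * B * B"
    unfolding norm_mult using assms by (intro mult_mono) auto
  then show ?thesis by (simp add: power3_eq_cube)
qed

lemma inner_series_has_sum:
  assumes q: "norm q < 1"
  shows "((\<lambda>b. geom2 q b * (qpoch q a * qpoch q b / qpoch q (a + b))) has_sum
    (suminf (geom2 q) + (\<Sum>j=1..a. geom2 q j * (qpoch q j - 1)))) UNIV"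
proof -
  obtain B where "\<And>n. norm (qpoch q n) \<le> B" "\<And>n. norm (1 / qpoch q n) \<le> B" "B \<ge> 0"
    using qpoch_bounds[OF q] by blast
  then show ?thesis
    by (intro norm_summable_imp_has_sum inner_series_sums q summable_norm_geom2_mult[where c = "B ^ 3"] norm_qpoch_ratio_le)
qed

lemma normalized_kernel_tendsto:
  assumes q: "norm q < 1"
  shows "(\<lambda>n. (qpoch q n)\<^sup>2 * bailey_kernel q n r) \<longlonglongrightarrow> 1"
proof -
  have "(\<lambda>n. (qpoch q (n + r))\<^sup>2 * (1 / (qpoch q n * qpoch q (n + 2 * r)))) \<longlonglongrightarrow>
      (qpoch_inf q q)\<^sup>2 * (1 / (qpoch_inf q q * qpoch_inf q q))"
    using qpoch_tendsto[OF q] qpoch_inf_nonzero[OF q]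
    by (intro tendsto_intros LIMSEQ_ignore_initial_segment) auto
  then have "(\<lambda>n. (qpoch q (n + r))\<^sup>2 * bailey_kernel q (n + r) r) \<longlonglongrightarrow> 1"
    using qpoch_inf_nonzero[OF q] by (simp add: bailey_kernel_def power2_eq_square mult_2 add.assoc)
  then show ?thesis by (rule LIMSEQ_offset)
qed

lemma norm_bailey_alpha_le:
  assumes q: "norm q < 1"
  shows "norm (bailey_alpha q r) \<le> 2"
proof -
  have "norm (1 + q ^ r) \<le> 1 + norm q ^ r"
    using norm_triangle_ineq[of 1 "q ^ r"] by (simp add: norm_power)
  also have "\<dots> \<le> 2" using q by (simp add: power_le_one)
  finally have "norm q ^ (3 * (r choose 2) + r) * norm (1 + q ^ r) \<le> 1 * 2"
    using q by (intro mult_mono power_le_one) auto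
  then show ?thesis by (simp add: bailey_alpha_def norm_mult norm_power)
qed

text \<open>
  The partial sums are known in closed form by \<open>double_sum_geom2_qpoch\<close>, and the normalised kernel in
  that closed form is bounded and tends to $1$ for fixed $r$; hence the limit may be taken termwise.
\<close>
lemma correction_series_sums:
  assumes q: "norm q < 1"
  shows "(\<lambda>a. geom2 q a * (\<Sum>j=1..a. geom2 q j * (qpoch q j - 1))) sums
    (\<Sum>r. (geom2 q r)\<^sup>2 * bailey_alpha q r)"
proof -
  obtain B where B: "\<And>n. norm (qpoch q n) \<le> B" "\<And>n. norm (1 / qpoch q n) \<le> B" "B \<ge> 0"
    using qpoch_bounds[OF q] by blast
  let ?t = "\<lambda>r. (geom2 q r)\<^sup>2 * bailey_alpha q r"
  let ?G = "\<lambda>n r. (qpoch q n)\<^sup>2 * bailey_kernel q n r"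
  define c where "c = 1 / (1 - norm q)\<^sup>2"
  have "c \<ge> 0" by (simp add: c_def)
  have G: "norm (?G n r) \<le> B ^ 4" for n r
  proof (cases "r \<le> n")
    case True
    have "norm (qpoch q n * qpoch q n * (1 / qpoch q (n - r)) * (1 / qpoch q (n + r))) \<le> B * B * B * B"
      unfolding norm_mult using B by (intro mult_mono) auto
    also have "qpoch q n * qpoch q n * (1 / qpoch q (n - r)) * (1 / qpoch q (n + r)) = ?G n r"
      using True by (simp add: bailey_kernel_def power2_eq_square)
    finally show ?thesis by (simp add: power4_eq_xxxx)
  qed (use B in \<open>simp add: bailey_kernel_def\<close>)
  have geom2_le: "norm (geom2 q r) \<le> c" for r
  proof -
    have "norm (geom2 q r) \<le> norm q ^ r * c" using norm_geom2_le[OF q, of r] by (simp add: c_def)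
    also have "\<dots> \<le> 1 * c" using q \<open>c \<ge> 0\<close> by (intro mult_right_mono power_le_one) auto
    finally show ?thesis by simp
  qed
  have bound: "norm (?t r * ?G n r) \<le> norm (geom2 q r) * (c * 2 * B ^ 4)" for n r
  proof -
    have "norm (geom2 q r) * norm (geom2 q r) * norm (bailey_alpha q r) * norm (?G n r)
        \<le> norm (geom2 q r) * c * 2 * B ^ 4"
      using B(3) \<open>c \<ge> 0\<close> by (intro mult_mono geom2_le norm_bailey_alpha_le q G) auto
    then show ?thesis by (simp add: norm_mult power2_eq_square mult_ac)
  qed
  have "(\<lambda>n. suminf (\<lambda>r. ?t r * ?G n r)) \<longlonglongrightarrow> suminf ?t"
  proof (rule tannerys_theorem[THEN conjunct2, THEN conjunct2])
    show "((\<lambda>n. ?t r * ?G n r) \<longlonglongrightarrow> ?t r)" for r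
      using tendsto_mult[OF tendsto_const normalized_kernel_tendsto[OF q]] by fastforce
    show "\<forall>\<^sub>F (r, n) in at_top \<times>\<^sub>F sequentially. norm (?t r * ?G n r) \<le> norm (geom2 q r) * (c * 2 * B ^ 4)"
      using bound by (intro always_eventually) auto
    show "summable (\<lambda>r. norm (geom2 q r) * (c * 2 * B ^ 4))"
      by (intro summable_mult2 summable_norm_geom2 q)
  qed simp
  also have "(\<lambda>n. suminf (\<lambda>r. ?t r * ?G n r)) = (\<lambda>n. \<Sum>r=1..n. ?t r * ?G n r)"
  proof
    show "suminf (\<lambda>r. ?t r * ?G n r) = (\<Sum>r=1..n. ?t r * ?G n r)" for n
      by (rule suminf_finite) (auto simp: bailey_kernel_def not_less_eq_eq Suc_le_eq)
  qed
  finally have "(\<lambda>n. \<Sum>a=1..n. geom2 q a * (\<Sum>j=1..a. geom2 q j * (qpoch q j - 1))) \<longlonglongrightarrow> suminf ?t"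
    by (simp only: double_sum_geom2_qpoch[OF q])
  also have "(\<lambda>n. \<Sum>a=1..n. geom2 q a * (\<Sum>j=1..a. geom2 q j * (qpoch q j - 1))) =
      (\<lambda>n. \<Sum>a\<le>n. geom2 q a * (\<Sum>j=1..a. geom2 q j * (qpoch q j - 1)))"
    by (intro ext sum.mono_neutral_left) (auto simp: not_less_eq_eq)
  finally show ?thesis by (simp add: sums_def_le)
qed

lemma outer_series_has_sum:
  assumes q: "norm q < 1"
  shows "((\<lambda>a. geom2 q a * (suminf (geom2 q) + (\<Sum>j=1..a. geom2 q j * (qpoch q j - 1)))) has_sum
    ((suminf (geom2 q))\<^sup>2 + (\<Sum>r. (geom2 q r)\<^sup>2 * bailey_alpha q r))) UNIV"
proof (rule norm_summable_imp_has_sum)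
  have "summable (geom2 q)" using summable_norm_geom2[OF q] by (rule summable_norm_cancel)
  from sums_add[OF sums_mult2[OF summable_sums[OF this], of "suminf (geom2 q)"] correction_series_sums[OF q]]
  show "(\<lambda>a. geom2 q a * (suminf (geom2 q) + (\<Sum>j=1..a. geom2 q j * (qpoch q j - 1)))) sums
      ((suminf (geom2 q))\<^sup>2 + (\<Sum>r. (geom2 q r)\<^sup>2 * bailey_alpha q r))"
    by (simp add: power2_eq_square distrib_left)
  obtain B where B: "\<And>n. norm (qpoch q n) \<le> B"
    by (rule qpoch_bounds[OF q]) blast
  have "norm (suminf (geom2 q) + (\<Sum>j=1..a. geom2 q j * (qpoch q j - 1))) \<le>
      norm (suminf (geom2 q)) + (\<Sum>j. norm (geom2 q j * (qpoch q j - 1)))" for a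
  proof -
    have "norm (qpoch q j - 1) \<le> B + 1" for j
      using norm_triangle_ineq4[of "qpoch q j" 1] B(1)[of j] by simp
    from summable_norm_geom2_mult[OF q this]
    have "(\<Sum>j=1..a. norm (geom2 q j * (qpoch q j - 1))) \<le> (\<Sum>j. norm (geom2 q j * (qpoch q j - 1)))"
      by (intro sum_le_suminf) auto
    then have "norm (\<Sum>j=1..a. geom2 q j * (qpoch q j - 1)) \<le> (\<Sum>j. norm (geom2 q j * (qpoch q j - 1)))"
      by (rule order_trans[OF norm_sum])
    then show ?thesis by (intro norm_triangle_le add_left_mono)
  qed
  then show "summable (\<lambda>a. norm (geom2 q a * (suminf (geom2 q) + (\<Sum>j=1..a. geom2 q j * (qpoch q j - 1)))))"
    by (rule summable_norm_geom2_mult[OF q])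
qed

section \<open>The Lambert series and the bilateral series\<close>

lemma has_sum_UNIV_iff_atLeast_1:
  fixes f :: "nat \<Rightarrow> 'a::{comm_monoid_add, topological_space}"
  assumes "f 0 = 0"
  shows "(f has_sum S) UNIV \<longleftrightarrow> (f has_sum S) {1..}"
  by (rule has_sum_cong_neutral) (use assms in \<open>auto simp: not_less_eq_eq\<close>)

lemma nat_mult_power_sums:
  fixes z :: "'a :: {real_normed_field, banach}"
  assumes "norm z < 1"
  shows "(\<lambda>i. of_nat i * z ^ i) sums (z / (1 - z)\<^sup>2)"
proof -
  have "(\<lambda>i. of_nat (Suc i) * z ^ Suc i) sums (z / (1 - z)\<^sup>2)"
    using sums_mult[OF geometric_deriv_sums[OF assms], of z] by (simp add: mult_ac)
  then show ?thesis
    unfolding sums_Suc_iff[of "\<lambda>i. of_nat i * z ^ i"] by simp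
qed

lemma has_sum_nat_mult_power:
  fixes z :: "'a :: {real_normed_field, banach}"
  assumes z: "norm z < 1"
  shows "((\<lambda>i. of_nat i * z ^ i) has_sum (z / (1 - z)\<^sup>2)) {1..}"
proof -
  have "summable (\<lambda>i. norm (of_nat i * z ^ i))"
    using nat_mult_power_sums[of "norm z"] z by (auto simp: norm_mult norm_power sums_iff)
  from norm_summable_imp_has_sum[OF this nat_mult_power_sums[OF z]] show ?thesis
    by (subst (asm) has_sum_UNIV_iff_atLeast_1) simp_all
qed

lemma has_sum_power_atLeast_1:
  fixes z :: "'a :: {real_normed_field, banach}"
  assumes z: "norm z < 1"
  shows "((\<lambda>i. z ^ i) has_sum (z / (1 - z))) {1..}"
proof -
  have "((\<lambda>i. z * z ^ i) has_sum (z * (1 / (1 - z)))) UNIV"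
    using z by (intro has_sum_cmult_right norm_summable_imp_has_sum geometric_sums)
      (simp_all add: norm_power summable_geometric)
  then have "((\<lambda>i. z ^ i) has_sum (z / (1 - z))) (range Suc)"
    by (subst has_sum_reindex) (simp_all add: o_def)
  also have "range Suc = {1..}"
    by (auto simp: image_iff Suc_le_eq gr0_conv_Suc)
  finally show ?thesis .
qed

lemma weighted_geom_eq:
  assumes q: "norm q < 1" and m: "m \<ge> 1"
  shows "(\<lambda>i. of_nat i * q ^ (i * m)) summable_on {1..}" "weighted_geom q m = geom2 q m"
proof -
  have "norm (q ^ m) < 1" using q m by (simp add: norm_power power_less_one_iff)
  from has_sum_nat_mult_power[OF this]
  have *: "((\<lambda>i. of_nat i * q ^ (i * m)) has_sum geom2 q m) {1..}"
    by (simp add: geom2_def mult.commute flip: power_mult)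
  show "(\<lambda>i. of_nat i * q ^ (i * m)) summable_on {1..}" "weighted_geom q m = geom2 q m"
    using * by (auto simp: weighted_geom_def infsumI has_sum_imp_summable)
qed

text \<open>
  The double series of $i q^{im}$ is absolutely convergent. Its rows (fixed $m$) sum to
  \<open>geom2 q m\<close>, and its columns (fixed $i$) to $i q^i/(1-q^i)$.
\<close>
lemma Lambert_has_sum:
  assumes q: "norm q < 1"
  shows "((\<lambda>n. of_nat n * q ^ n / (1 - q ^ n)) has_sum suminf (geom2 q)) {1..}"
proof -
  let ?f = "\<lambda>(m, i). of_nat i * q ^ (i * m)"
  have norm_lt: "norm (q ^ m) < 1" if "m \<ge> 1" for m
    using q that by (simp add: norm_power power_less_one_iff)
  have rows: "((\<lambda>i. ?f (m, i)) has_sum geom2 q m) {1..}" if "m \<ge> 1" for m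
    using has_sum_nat_mult_power[OF norm_lt[OF that]]
    by (simp add: geom2_def mult.commute flip: power_mult)
  have columns: "((\<lambda>m. ?f (m, i)) has_sum (of_nat i * q ^ i / (1 - q ^ i))) {1..}" if "i \<ge> 1" for i
    using has_sum_cmult_right[OF has_sum_power_atLeast_1[OF norm_lt[OF that]], of "of_nat i"]
    by (simp flip: power_mult)
  have norm_rows: "((\<lambda>i. norm (?f (m, i))) has_sum (norm q ^ m / (1 - norm q ^ m)\<^sup>2)) {1..}" if "m \<ge> 1" for m
    using has_sum_nat_mult_power[of "norm q ^ m"] norm_lt[OF that]
    by (simp add: norm_mult norm_power mult.commute flip: power_mult)
  have "(\<lambda>x. norm (?f x)) summable_on ({1..} \<times> {1..})"
    unfolding Infinite_Sum.abs_summable_on_Sigma_iff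
  proof (intro conjI ballI)
    show "(\<lambda>i. norm (?f (m, i))) summable_on {1..}" if "m \<in> {1..}" for m
      using norm_rows[of m] that by (auto intro: has_sum_imp_summable)
    have le: "norm (norm q ^ m / (1 - norm q ^ m)\<^sup>2) \<le> norm (norm q ^ m / (1 - norm q)\<^sup>2)" if "m \<ge> 1" for m
      using norm_power_over_le[of "norm q" m m 2] q that by (simp add: norm_divide norm_power)
    have "(\<lambda>m. norm (norm q ^ m / (1 - norm q)\<^sup>2)) summable_on {1..}"
    proof -
      have "((\<lambda>m. norm q ^ m * (1 / (1 - norm q)\<^sup>2)) has_sum (norm q / (1 - norm q) * (1 / (1 - norm q)\<^sup>2))) {1..}"
        using q by (intro has_sum_cmult_left has_sum_power_atLeast_1) simp
      then show ?thesis by (auto dest!: has_sum_imp_summable simp: norm_power norm_divide)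
    qed
    then have "(\<lambda>m. norm (norm q ^ m / (1 - norm q ^ m)\<^sup>2)) summable_on {1..}"
      by (rule Infinite_Sum.abs_summable_on_comparison_test) (use le in auto)
    then show "(\<lambda>m. norm (\<Sum>\<^sub>\<infinity>i\<in>{1..}. norm (?f (m, i)))) summable_on {1..}"
      by (rule summable_on_cong[THEN iffD1, rotated]) (subst norm_rows[THEN infsumI], simp_all)
  qed
  then have "?f summable_on ({1..} \<times> {1..})" by (rule abs_summable_summable)
  then obtain S where S: "(?f has_sum S) ({1..} \<times> {1..})" by (auto simp: summable_on_def)
  have "(geom2 q has_sum S) {1..}"
    by (rule has_sum_SigmaD[OF S]) (use rows in auto)
  moreover have "(geom2 q has_sum suminf (geom2 q)) {1..}"
    using summable_norm_geom2[OF q]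
    by (subst has_sum_UNIV_iff_atLeast_1[symmetric])
      (auto intro!: norm_summable_imp_has_sum summable_sums dest: summable_norm_cancel)
  ultimately have "S = suminf (geom2 q)" by (rule has_sum_unique)
  moreover have "((\<lambda>n. of_nat n * q ^ n / (1 - q ^ n)) has_sum S) {1..}"
    by (rule has_sum_SigmaD[OF has_sum_swap[THEN iffD1, OF S]]) (use columns in auto)
  ultimately show ?thesis by simp
qed

text \<open>
  The two exponents $3m(m+1)/2$ and $m(3m+5)/2$ differ by $m$, which is the origin of the factor $1 + q^m$ in
  \<open>bailey_alpha\<close>.
\<close>
lemma bilateral_term_pair:
  assumes m: "m \<ge> 1"
  shows "bilateral_term q (int m) + bilateral_term q (- int m) = (geom2 q m)\<^sup>2 * bailey_alpha q m"
proof -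
  have "even (m * (m - 1))" by (cases m) auto
  then have choose: "2 * (m choose 2) = m * (m - 1)" by (simp add: choose_two)
  obtain k where "m = Suc k" using m by (cases m) auto
  with choose have "3 * m * (m + 1) = 2 * (3 * (m choose 2) + 3 * m)"
      "m * (3 * m + 5) = 2 * (3 * (m choose 2) + 4 * m)"
    by (simp_all add: algebra_simps)
  then have exps: "3 * m * (m + 1) div 2 = 3 * (m choose 2) + 3 * m"
      "m * (3 * m + 5) div 2 = 3 * (m choose 2) + 4 * m" by simp_all
  define y where "y = q ^ m"
  have powers: "q ^ (numeral j * m) = y ^ numeral j" for j
    by (simp add: y_def mult.commute flip: power_mult)
  have "s * (w * y ^ 3) + s * (w * y ^ 4) = y\<^sup>2 * (s * (w * y) * (1 + y))" for s w
    by algebra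
  then show ?thesis
    unfolding bilateral_term_pos[OF m] bilateral_term_neg[OF m] exps bailey_alpha_def geom2_def power_add powers
      y_def[symmetric] add_divide_distrib[symmetric]
    by (simp add: power_divide flip: power_mult)
qed

lemma bilateral_has_sum:
  assumes q: "norm q < 1"
  shows "(bilateral_term q has_sum (\<Sum>r. (geom2 q r)\<^sup>2 * bailey_alpha q r)) {n. n \<noteq> 0}"
proof -
  let ?p = "\<lambda>m. bilateral_term q (int m)" and ?n = "\<lambda>m. bilateral_term q (- int m)"
  let ?t = "\<lambda>r. (geom2 q r)\<^sup>2 * bailey_alpha q r"
  \<comment> \<open>Both halves of the series have this form, with an exponent that is at least the index.\<close>
  have dominated: "f summable_on {1..}"
    if f: "\<And>m. m \<ge> 1 \<Longrightarrow> f m = (-1) ^ m * q ^ e m / (1 - q ^ m) ^ 4"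
      and e: "\<And>m. m \<ge> 1 \<Longrightarrow> e m \<ge> m" for f e
  proof (rule abs_summable_summable, rule Infinite_Sum.abs_summable_on_comparison_test)
    have "((\<lambda>m. norm q ^ m * (1 / (1 - norm q) ^ 4)) has_sum (norm q / (1 - norm q) * (1 / (1 - norm q) ^ 4))) {1..}"
      using q by (intro has_sum_cmult_left has_sum_power_atLeast_1) simp
    then show "(\<lambda>m. norm (norm q ^ m / (1 - norm q) ^ 4)) summable_on {1..}"
      by (auto dest!: has_sum_imp_summable simp: norm_power norm_divide)
    show "norm (f m) \<le> norm (norm q ^ m / (1 - norm q) ^ 4)" if "m \<in> {1..}" for m
      using norm_power_over_le[OF q, of m "e m" 4] that e[of m] f[of m]
      by (simp add: norm_mult norm_power norm_divide)
  qed
  have "?p summable_on {1..}"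
    by (rule dominated[OF bilateral_term_pos]) (auto simp: less_eq_div_iff_mult_less_eq)
  then obtain P where P: "(?p has_sum P) {1..}" by (auto simp: summable_on_def)
  have "?n summable_on {1..}"
    by (rule dominated[OF bilateral_term_neg]) (auto simp: less_eq_div_iff_mult_less_eq)
  then obtain N where N: "(?n has_sum N) {1..}" by (auto simp: summable_on_def)
  have "(?t has_sum (P + N)) {1..}"
    using has_sum_add[OF P N] by (subst has_sum_cong[where g = "\<lambda>m. ?p m + ?n m"]) (auto simp: bilateral_term_pair)
  then have "(?t has_sum (P + N)) UNIV"
    by (subst has_sum_UNIV_iff_atLeast_1) simp_all
  then have sum: "P + N = suminf ?t"
    by (simp add: has_sum_imp_sums sums_unique)
  have "(bilateral_term q has_sum (P + N)) (int ` {1..} \<union> (\<lambda>m. - int m) ` {1..})"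
  proof (rule has_sum_Un_disjoint)
    show "(bilateral_term q has_sum P) (int ` {1..})"
      using P by (subst has_sum_reindex) (auto simp: inj_on_def o_def)
    show "(bilateral_term q has_sum N) ((\<lambda>m. - int m) ` {1..})"
      using N by (subst has_sum_reindex) (auto simp: inj_on_def o_def)
  qed auto
  also have "int ` {1..} \<union> (\<lambda>m. - int m) ` {1..} = {n. n \<noteq> 0}"
  proof (intro equalityI subsetI)
    fix n :: int assume "n \<in> {n. n \<noteq> 0}"
    then show "n \<in> int ` {1..} \<union> (\<lambda>m. - int m) ` {1..}"
      by (cases n rule: int_cases2) (auto simp: Suc_le_eq)
  qed auto
  finally show ?thesis unfolding sum .
qed

section \<open>The identity\<close>

theorem theorem1:
  fixes q :: complex
  assumes "norm q < 1"
  shows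
    "(\<forall>X. convergent_prod (\<lambda>k. 1 - X * q ^ k)) \<and>
     (\<forall>m\<ge>1. (\<lambda>i. of_nat i * q ^ (i * m)) summable_on {1..}) \<and>
     (\<forall>n\<^sub>1\<ge>1. (\<lambda>n\<^sub>2. weighted_geom q n\<^sub>2 * (1 / (\<Prod>k=1..n\<^sub>1. 1 - q ^ (n\<^sub>2 + k)))) summable_on {1..}) \<and>
     (\<lambda>n\<^sub>1. weighted_geom q n\<^sub>1 * (1 / qpoch_inf (q ^ (n\<^sub>1 + 1)) q) *
        (\<Sum>\<^sub>\<infinity>n\<^sub>2\<in>{1..}. weighted_geom q n\<^sub>2 * (1 / (\<Prod>k=1..n\<^sub>1. 1 - q ^ (n\<^sub>2 + k))))) summable_on {1..} \<and>
     (\<lambda>n::nat. of_nat n * q ^ n / (1 - q ^ n)) summable_on {1..} \<and>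
     bilateral_term q summable_on {n. n \<noteq> 0} \<and>
     (\<Sum>\<^sub>\<infinity>n\<^sub>1\<in>{1..}. weighted_geom q n\<^sub>1 * (1 / qpoch_inf (q ^ (n\<^sub>1 + 1)) q) *
        (\<Sum>\<^sub>\<infinity>n\<^sub>2\<in>{1..}. weighted_geom q n\<^sub>2 * (1 / (\<Prod>k=1..n\<^sub>1. 1 - q ^ (n\<^sub>2 + k)))))
     = 1 / qpoch_inf q q * (\<Sum>\<^sub>\<infinity>n\<in>{1::nat..}. of_nat n * q ^ n / (1 - q ^ n))\<^sup>2
       + 1 / qpoch_inf q q * (\<Sum>\<^sub>\<infinity>n\<in>{n. n \<noteq> 0}. bilateral_term q n)"
proof -
  let ?Q = "qpoch_inf q q"
  let ?inner = "\<lambda>a b. weighted_geom q b * (1 / (\<Prod>k=1..a. 1 - q ^ (b + k)))"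
  define F where "F a = suminf (geom2 q) + (\<Sum>j=1..a. geom2 q j * (qpoch q j - 1))" for a
  have prod: "(\<Prod>k=1..a. 1 - q ^ (b + k)) = qpoch q (a + b) / qpoch q b" for a b
    using qpoch_nonzero[OF assms, of b] by (induction a) (simp_all add: qpoch_Suc add.commute)
  have inner: "(?inner a has_sum (F a / qpoch q a)) {1..}" for a
  proof -
    have "((\<lambda>b. geom2 q b * (qpoch q a * qpoch q b / qpoch q (a + b))) has_sum F a) {1..}"
      using inner_series_has_sum[OF assms, of a] unfolding F_def
      by (subst (asm) has_sum_UNIV_iff_atLeast_1) simp_all
    from has_sum_cmult_left[OF this, of "1 / qpoch q a"]
    have "((\<lambda>b. geom2 q b * (qpoch q b / qpoch q (a + b))) has_sum (F a / qpoch q a)) {1..}"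
      using qpoch_nonzero[OF assms, of a] by simp
    then show ?thesis
      by (rule has_sum_cong[THEN iffD1, rotated]) (simp add: weighted_geom_eq[OF assms] prod[unfolded One_nat_def])
  qed
  have outer: "((\<lambda>a. weighted_geom q a * (1 / qpoch_inf (q ^ (a + 1)) q) * infsum (?inner a) {1..})
     has_sum (1 / ?Q * ((suminf (geom2 q))\<^sup>2 + (\<Sum>r. (geom2 q r)\<^sup>2 * bailey_alpha q r)))) {1..}"
  proof -
    have "((\<lambda>a. geom2 q a * F a) has_sum ((suminf (geom2 q))\<^sup>2 + (\<Sum>r. (geom2 q r)\<^sup>2 * bailey_alpha q r))) {1..}"
      using outer_series_has_sum[OF assms] unfolding F_def
      by (subst (asm) has_sum_UNIV_iff_atLeast_1) simp_all
    from has_sum_cmult_right[OF this, of "1 / ?Q"] show ?thesis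
      by (rule has_sum_cong[THEN iffD1, rotated])
        (subst infsumI[OF inner], use qpoch_nonzero[OF assms] in \<open>simp add: weighted_geom_eq[OF assms] qpoch_inf_tail[OF assms, simplified]\<close>)
  qed
  note lambert = Lambert_has_sum[OF assms]
  note bilateral = bilateral_has_sum[OF assms]
  show ?thesis
    unfolding infsumI[OF outer] infsumI[OF lambert] infsumI[OF bilateral]
    using convergent_prod_qpoch[OF assms] weighted_geom_eq(1)[OF assms]
      inner[THEN has_sum_imp_summable] outer[THEN has_sum_imp_summable]
      lambert[THEN has_sum_imp_summable] bilateral[THEN has_sum_imp_summable]
    by (simp add: distrib_left)
qed

end
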